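(* Let $k\ge2$ and $n\ge1$ be integers. In the Tower of Hanoi problem on the star graph $\mathrm{S}_k$, the $n$ disks can be transferred from one leaf of the graph to another leaf using at most $\mathrm{G}_{k+1}(n)$ moves, where $\mathrm{G}_{k+1}(n)$ is the generalized Frame–Stewart number with $(p_3,q_3)=(3,2)$ and $(p_i,q_i)=(2,1)$ for $4\le i\le k+1$. That is, $\mathrm{G}_{k+1}(n)$ is an upper bound on the minimum number of moves for this problem.
   Context: The star graph $\mathrm{S}_k$ has $k+1$ vertices: one center vertex adjacent to each of $k$ leaves, and no other edges. Tower of Hanoi on a graph: a peg is placed at each vertex; $n$ disks of distinct sizes initially form a pile on one peg (largest at the bottom); a move takes the topmost disk of some peg and places it on a peg that is adjacent in the graph and that is either empty or whose top disk is larger; the goal is to move all disks onto a specified destination peg. Generalized Frame–Stewart numbers: for positive integer sequences $(p_i)_{i\ge3}$, $(q_i)_{i\ge3}$, $\mathrm{G}_m(0)=0$ for $m\ge3$; $\mathrm{G}_3(n)=p_3\mathrm{G}_3(n-1)+q_3$ for $n\ge1$; and $\mathrm{G}_m(n)=\min_{1\le t\le n}\{p_m\mathrm{G}_m(n-t)+q_m\mathrm{G}_{m-1}(t)\}$ for $m\ge4$, $n\ge1$. *)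

theory Defs
  imports Main
begin

text \<open>A graph is given by its vertex set and its set of (unordered) edges.\<close>

type_synonym 'v graph = "'v set \<times> 'v set set"

definition adjacent :: "'v graph \<Rightarrow> 'v \<Rightarrow> 'v \<Rightarrow> bool" where
  "adjacent G v w \<longleftrightarrow> v \<in> fst G \<and> w \<in> fst G \<and> v \<noteq> w \<and> {v, w} \<in> snd G"

text \<open>The center of the star is \<open>0\<close>.\<close>

definition star_leaves :: "nat \<Rightarrow> nat set" where
  "star_leaves k = {1..k}"

definition star_graph :: "nat \<Rightarrow> nat graph" where
  "star_graph k = (insert 0 (star_leaves k), (\<lambda>i. {0, i}) ` star_leaves k)"

text \<open>Disks are identified with their sizes. A configuration assigns to each peg its list of
  disks, the topmost disk being the head of the list.\<close>

type_synonym 'v config = "'v \<Rightarrow> nat list"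

definition pile :: "nat \<Rightarrow> 'v \<Rightarrow> 'v config" where
  "pile n a = (\<lambda>v. if v = a then [1..<Suc n] else [])"

definition hanoi_move :: "'v graph \<Rightarrow> 'v config \<Rightarrow> 'v config \<Rightarrow> bool" where
  "hanoi_move G s s' \<longleftrightarrow>
     (\<exists>v w d ds. adjacent G v w \<and> s v = d # ds \<and> (s w = [] \<or> d < hd (s w)) \<and>
        s' = s(v := ds, w := d # s w))"

definition transferable :: "'v graph \<Rightarrow> nat \<Rightarrow> 'v \<Rightarrow> 'v \<Rightarrow> nat \<Rightarrow> bool" where
  "transferable G n a b m \<longleftrightarrow> (hanoi_move G ^^ m) (pile n a) (pile n b)"

text \<open>Only meaningful if some number of moves suffices.\<close>

definition min_moves :: "'v graph \<Rightarrow> nat \<Rightarrow> 'v \<Rightarrow> 'v \<Rightarrow> nat" where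
  "min_moves G n a b = (LEAST m. transferable G n a b m)"

text \<open>Generalized Frame--Stewart numbers; the first index is meant to be at least \<open>3\<close>, and the
  value \<open>0\<close> for smaller indices is a dummy. The three recurrences are derived below.\<close>

function frame_stewart :: "(nat \<Rightarrow> nat) \<Rightarrow> (nat \<Rightarrow> nat) \<Rightarrow> nat \<Rightarrow> nat \<Rightarrow> nat" where
  "frame_stewart p q m n =
     (if m < 3 \<or> n = 0 then 0
      else if m = 3 then p 3 * frame_stewart p q 3 (n - 1) + q 3
      else MIN t\<in>{1..n}. p m * frame_stewart p q m (n - t) + q m * frame_stewart p q (m - 1) t)"
  by pat_completeness auto
termination
  by (relation "measures [\<lambda>(p, q, m, n). m, \<lambda>(p, q, m, n). n]") auto

declare frame_stewart.simps [simp del]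

lemma frame_stewart_0: "frame_stewart p q m 0 = 0"
  by (simp add: frame_stewart.simps)

lemma frame_stewart_3:
  "n \<ge> 1 \<Longrightarrow> frame_stewart p q 3 n = p 3 * frame_stewart p q 3 (n - 1) + q 3"
  by (subst frame_stewart.simps) simp

lemma frame_stewart_ge_4:
  "m \<ge> 4 \<Longrightarrow> n \<ge> 1 \<Longrightarrow> frame_stewart p q m n =
     (MIN t\<in>{1..n}. p m * frame_stewart p q m (n - t) + q m * frame_stewart p q (m - 1) t)"
  by (subst frame_stewart.simps) simp

end

theory Submission
  imports Defs
begin

text \<open>Larger disks do not obstruct the moves of smaller ones, so it suffices to move a pile lying on
  top of an arbitrary configuration of larger disks, using only a subset \<open>L\<close> of the leaves. With two
  leaves, the pile is moved by recursion on its largest disk, as on a path of three pegs. With more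
  leaves, the smallest \<open>n - t\<close> disks are parked on a third leaf \<open>c\<close>, the others are moved without
  using \<open>c\<close>, and the parked ones are then put on top of them.\<close>

definition reachable_within :: "'v graph \<Rightarrow> nat \<Rightarrow> 'v config \<Rightarrow> 'v config \<Rightarrow> bool" where
  "reachable_within G N s s' \<longleftrightarrow> (\<exists>m\<le>N. (hanoi_move G ^^ m) s s')"

lemma reachable_within_refl: "reachable_within G N s s"
  unfolding reachable_within_def by (rule exI [of _ 0]) simp

lemma reachable_within_move: "hanoi_move G s s' \<Longrightarrow> reachable_within G 1 s s'"
  unfolding reachable_within_def by (rule exI [of _ 1]) (simp add: relcompp.simps)

lemma reachable_within_trans [trans]:
  assumes "reachable_within G M s s'" and "reachable_within G N s' s''"
  shows "reachable_within G (M + N) s s''"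
proof -
  from assms obtain i j where "i \<le> M" "(hanoi_move G ^^ i) s s'" "j \<le> N" "(hanoi_move G ^^ j) s' s''"
    unfolding reachable_within_def by blast
  then have "(hanoi_move G ^^ (i + j)) s s''" "i + j \<le> M + N"
    by (auto simp: relpowp_add)
  then show ?thesis unfolding reachable_within_def by blast
qed

text \<open>Comparing with every disk of a peg, not just its top one, covers empty pegs without a
  case distinction.\<close>

definition fits_on :: "nat list \<Rightarrow> 'v set \<Rightarrow> 'v config \<Rightarrow> bool" where
  "fits_on xs V s \<longleftrightarrow> (\<forall>v\<in>V. \<forall>x\<in>set xs. \<forall>y\<in>set (s v). x < y)"

text \<open>The background \<open>s\<close> omits the moved disk, so that the two configurations
  have the same shape as in the transfer lemmas and the steps can be chained.\<close>

lemma reachable_within_single_disk: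
  assumes "adjacent G v w" and "fits_on [d] {w} s"
  shows "reachable_within G 1 (s(v := d # s v)) (s(w := d # s w))"
proof (rule reachable_within_move)
  have "v \<noteq> w" using assms(1) by (simp add: adjacent_def)
  moreover have "s w = [] \<or> d < hd (s w)"
    using assms(2) by (cases "s w") (auto simp: fits_on_def)
  ultimately show "hanoi_move G (s(v := d # s v)) (s(w := d # s w))"
    unfolding hanoi_move_def using assms(1)
    by (intro exI [of _ v] exI [of _ w] exI [of _ d] exI [of _ "s v"]) (auto simp: fun_eq_iff)
qed

lemma adjacent_star_center:
  assumes "i \<in> star_leaves k"
  shows "adjacent (star_graph k) 0 i" and "adjacent (star_graph k) i 0"
  using assms by (auto simp: adjacent_def star_graph_def star_leaves_def insert_commute)

text \<open>The largest disk goes from \<open>a\<close> to the center while the smaller ones wait on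
  \<open>b\<close>, and from the center to \<open>b\<close> while they wait on \<open>a\<close>.
  This takes three transfers of the smaller disks and two single moves, whence the coefficients 3
  and 2.\<close>

lemma transfer_two_leaves:
  assumes "a \<in> star_leaves k" and "b \<in> star_leaves k" and "a \<noteq> b"
    and "p 3 = 3" and "q 3 = 2"
    and "sorted_wrt (<) xs" and "fits_on xs {0, a, b} s"
  shows "reachable_within (star_graph k) (frame_stewart p q 3 (length xs))
    (s(a := xs @ s a)) (s(b := xs @ s b))"
  using assms
\<comment> \<open>The head of a list is the top of the pile, so the largest disk is the last
  entry.\<close>
proof (induction xs arbitrary: a b s rule: rev_induct)
  case Nil
  then show ?case by (simp add: reachable_within_refl)
next
  case (snoc d ys)
  let ?G = "star_graph k" and ?N = "frame_stewart p q 3 (length ys)"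
  have pegs: "a \<noteq> 0" "b \<noteq> 0" "a \<noteq> b"
    using snoc.prems by (auto simp: star_leaves_def)
  have ys: "sorted_wrt (<) ys" "\<And>y. y \<in> set ys \<Longrightarrow> y < d"
    using snoc.prems(6) by (auto simp: sorted_wrt_append)
  \<comment> \<open>Wherever \<open>d\<close> lies, it can be counted as part of the background when
    \<open>ys\<close> moves; the second form serves the way back from \<open>b\<close> to
    \<open>a\<close>.\<close>
  have fits: "fits_on ys {0, a, b} (s(v := d # s v))" "fits_on ys {0, b, a} (s(v := d # s v))" for v
    using snoc.prems(7) ys(2) by (auto simp: fits_on_def)
  have move_ys: "reachable_within ?G ?N (s'(a := ys @ s' a)) (s'(b := ys @ s' b))"
    "reachable_within ?G ?N (s'(b := ys @ s' b)) (s'(a := ys @ s' a))" if "s' = s(v := d # s v)" for s' v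
    unfolding that
    by (intro snoc.IH snoc.prems(1-5) snoc.prems(3) [symmetric] ys(1) fits)+
  have fits_d: "fits_on [d] {0} (s(b := ys @ s b))" "fits_on [d] {b} (s(a := ys @ s a))"
    using snoc.prems(7) pegs by (auto simp: fits_on_def)
  have "reachable_within ?G ?N (s(a := (ys @ [d]) @ s a)) (s(b := ys @ s b, a := d # s a))"
    using move_ys(1) [of "s(a := d # s a)" a] pegs by (simp add: fun_upd_twist)
  also have "reachable_within ?G 1 \<dots> (s(b := ys @ s b, 0 := d # s 0))"
    using reachable_within_single_disk [OF adjacent_star_center(2) [OF snoc.prems(1)] fits_d(1)] pegs
    by simp
  also have "reachable_within ?G ?N \<dots> (s(a := ys @ s a, 0 := d # s 0))"
    using move_ys(2) [of "s(0 := d # s 0)" 0] pegs by (simp add: fun_upd_twist)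
  also have "reachable_within ?G 1 \<dots> (s(a := ys @ s a, b := d # s b))"
    using reachable_within_single_disk [OF adjacent_star_center(1) [OF snoc.prems(2)] fits_d(2)] pegs
    by simp
  also have "reachable_within ?G ?N \<dots> (s(b := (ys @ [d]) @ s b))"
    using move_ys(1) [of "s(b := d # s b)" b] pegs by (simp add: fun_upd_twist)
  also have "?N + 1 + ?N + 1 + ?N = frame_stewart p q 3 (length (ys @ [d]))"
    using snoc.prems(4,5) by (simp add: frame_stewart_3)
  finally show ?case .
qed

text \<open>Each term of the minimum in the recurrence is the cost of a strategy, and a minimizing
  \<open>t\<close> gives the required bound. The center must admit the disks as well, since every
  move uses it.\<close>

lemma transfer_leaves:
  assumes "L \<subseteq> star_leaves k" and "card L \<ge> 2" and "a \<in> L" and "b \<in> L" and "a \<noteq> b"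
    and "p 3 = 3" and "q 3 = 2"
    and "\<And>i. 4 \<le> i \<Longrightarrow> i \<le> card L + 1 \<Longrightarrow> p i = 2 \<and> q i = 1"
    and "sorted_wrt (<) xs" and "fits_on xs (insert 0 L) s"
  shows "reachable_within (star_graph k) (frame_stewart p q (card L + 1) (length xs))
    (s(a := xs @ s a)) (s(b := xs @ s b))"
  using assms
\<comment> \<open>Parking keeps \<open>L\<close> but shortens the list, because \<open>t\<close> is
  at least 1. Moving the larger disks removes a leaf from \<open>L\<close>, while the list may keep
  its length when \<open>t = length xs\<close>. Hence the lexicographic order.\<close>
proof (induction "(card L, length xs)" arbitrary: L xs a b s
    rule: wf_induct_rule [OF wf_lex_prod [OF wf_less_than wf_less_than]])
  case 1
  note IH = 1(1) and prems = 1(2-)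
  let ?G = "star_graph k" and ?n = "length xs"
  have fin: "finite L" using prems(1) by (auto simp: star_leaves_def intro: finite_subset)
  consider "xs = []" | "card L = 2" | "card L \<ge> 3" "?n \<ge> 1"
    using prems(2) by (cases xs) force+
  then show ?case
  proof cases
    case 1
    then show ?thesis by (simp add: reachable_within_refl)
  next
    case 2
    then have "L = {a, b}"
      using prems(3-5) fin by (intro card_seteq [symmetric]) auto
    then show ?thesis
      using transfer_two_leaves [of a k b p q xs s] prems 2 by (simp add: numeral_eq_Suc)
  next
    case 3
    \<comment> \<open>The coefficients 2 and 1 are \<open>p\<close> and \<open>q\<close> at index
      \<open>card L + 1\<close>, which is at least 4 here.\<close>
    define F where "F t = 2 * frame_stewart p q (card L + 1) (?n - t) + frame_stewart p q (card L) t" for t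
    have "frame_stewart p q (card L + 1) ?n = Min (F ` {1..?n})"
      using 3 prems(8) [of "card L + 1"] by (simp add: frame_stewart_ge_4 F_def)
    moreover have "Min (F ` {1..?n}) \<in> F ` {1..?n}"
      using 3 by (intro Min_in) auto
    ultimately obtain t where t: "1 \<le> t" "t \<le> ?n" and F: "frame_stewart p q (card L + 1) ?n = F t"
      by auto
    define ys zs where "ys = take (?n - t) xs" and "zs = drop (?n - t) xs"
    have split: "xs = ys @ zs" and len: "length ys = ?n - t" "length zs = t"
      using t by (auto simp: ys_def zs_def)
    have sorted: "sorted_wrt (<) ys" "sorted_wrt (<) zs"
      and less: "\<And>y z. y \<in> set ys \<Longrightarrow> z \<in> set zs \<Longrightarrow> y < z"
      using prems(9) by (auto simp: split sorted_wrt_append)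
    have "\<not> L \<subseteq> {a, b}"
      using 3(1) prems(5) card_mono [of "{a, b}" L] by auto
    then obtain c where c: "c \<in> L" "c \<noteq> a" "c \<noteq> b" by auto
    have card: "card (L - {c}) = card L - 1" using c fin by simp
    have fits_ys: "fits_on ys (insert 0 L) (s(v := zs @ s v))" for v
      using prems(10) less by (auto simp: fits_on_def split)
    \<comment> \<open>The larger disks \<open>zs\<close> join the background on peg
      \<open>w\<close>: this is \<open>a\<close> when \<open>ys\<close> is parked and
      \<open>b\<close> when it returns.\<close>
    have move_ys: "reachable_within ?G (frame_stewart p q (card L + 1) (?n - t))
        (s'(u := ys @ s' u)) (s'(v := ys @ s' v))"
      if "s' = s(w := zs @ s w)" "u \<in> L" "v \<in> L" "u \<noteq> v" for s' u v w
    proof -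
      have "((card L, length ys), (card L, length xs)) \<in> less_than <*lex*> less_than"
        using t len by simp
      from IH [OF this prems(1,2) that(2-4) prems(6-8) sorted(1) fits_ys] show ?thesis
        unfolding that(1) len(1) .
    qed
    have move_zs: "reachable_within ?G (frame_stewart p q (card L) t)
        (s(c := ys @ s c, a := zs @ s a)) (s(c := ys @ s c, b := zs @ s b))"
    proof -
      have "((card (L - {c}), length zs), (card L, length xs)) \<in> less_than <*lex*> less_than"
        using 3(1) card by simp
      \<comment> \<open>The small disks on \<open>c\<close> block only \<open>c\<close>: it is a
        leaf, so the center stays usable.\<close>
      moreover have "fits_on zs (insert 0 (L - {c})) (s(c := ys @ s c))"
        using prems(1,10) c by (auto simp: fits_on_def split star_leaves_def)
      ultimately have "reachable_within ?G (frame_stewart p q (card (L - {c}) + 1) (length zs))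
        ((s(c := ys @ s c))(a := zs @ (s(c := ys @ s c)) a))
        ((s(c := ys @ s c))(b := zs @ (s(c := ys @ s c)) b))"
        using prems(1-8) 3(1) c card sorted(2) by (intro IH) auto
      then show ?thesis using c card len(2) 3(1) by simp
    qed
    have "reachable_within ?G (frame_stewart p q (card L + 1) (?n - t))
        (s(a := xs @ s a)) (s(c := ys @ s c, a := zs @ s a))"
      using move_ys [of "s(a := zs @ s a)" a a c] prems(3) c by (simp add: split fun_upd_twist)
    also note move_zs
    also have "reachable_within ?G (frame_stewart p q (card L + 1) (?n - t))
        (s(c := ys @ s c, b := zs @ s b)) (s(b := xs @ s b))"
      using move_ys [of "s(b := zs @ s b)" b c b] prems(4) c by (simp add: split fun_upd_twist)
    finally show ?thesis
      unfolding F F_def by (simp add: mult_2 ac_simps)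
  qed
qed

theorem theorem3:
  fixes k n a b :: nat and p q :: "nat \<Rightarrow> nat"
  assumes "k \<ge> 2" and "n \<ge> 1"
    and "\<And>i. i \<ge> 3 \<Longrightarrow> p i > 0" and "\<And>i. i \<ge> 3 \<Longrightarrow> q i > 0"
    and "p 3 = 3" and "q 3 = 2"
    and "\<And>i. 4 \<le> i \<Longrightarrow> i \<le> k + 1 \<Longrightarrow> p i = 2"
    and "\<And>i. 4 \<le> i \<Longrightarrow> i \<le> k + 1 \<Longrightarrow> q i = 1"
    and "a \<in> star_leaves k" and "b \<in> star_leaves k" and "a \<noteq> b"
  shows "(\<exists>m \<le> frame_stewart p q (k + 1) n. transferable (star_graph k) n a b m) \<and>
         min_moves (star_graph k) n a b \<le> frame_stewart p q (k + 1) n"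
proof -
  \<comment> \<open>With all leaves allowed, \<open>card L + 1\<close> is \<open>k + 1\<close>, and
    a pile is a list put on the empty background.\<close>
  have "reachable_within (star_graph k) (frame_stewart p q (k + 1) n) (pile n a) (pile n b)"
    using transfer_leaves [of "star_leaves k" k a b p q "[1..<Suc n]" "\<lambda>_. []"] assms
    by (simp add: star_leaves_def fits_on_def pile_def fun_upd_def del: upt_Suc One_nat_def)
  then obtain m where m: "m \<le> frame_stewart p q (k + 1) n" "transferable (star_graph k) n a b m"
    unfolding reachable_within_def transferable_def by blast
  moreover have "min_moves (star_graph k) n a b \<le> m"
    unfolding min_moves_def using m(2) by (rule Least_le)
  ultimately show ?thesis by auto
qed

end
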